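(* Let $P\in\mathbb{P}_m(\mathbb{C}^{n\times n})$ be a regular skew-symmetric matrix polynomial and let $L\in\mathbb{L}_1(P)$ be a skew-symmetric linearization of $P$ with normalized right ansatz vector $v$ ($\|v\|_2=1$). Let $(\lambda,x)\in\mathbb{C}\times\mathbb{C}^n$ be such that $\|x\|_2=1$ and $P(\lambda)x\ne0$. Let $\Lambda_{m-1}:=[\lambda^{m-1},\ldots,\lambda,1]^T$. With $\mathbb{S}$ denoting the skew-symmetric structure (skew-symmetric polynomials in $\mathbb{P}_m(\mathbb{C}^{n\times n})$ for $P$, skew-symmetric pencils in $\mathbb{P}_1(\mathbb{C}^{mn\times mn})$ for $L$), for $M\in\{2,F\}$ we have $$\sqrt{\frac{m+1}{2m}}\le\frac{\eta_M^{\mathbb{S}}(\lambda,\Lambda_{m-1}\otimes x,L;v)}{\eta_M^{\mathbb{S}}(\lambda,x,P)}=\frac{\eta(\lambda,\Lambda_{m-1}\otimes x,L;v)}{\eta(\lambda,x,P)}\le1.$$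
   Context: $m,n\ge1$ are integers. $\mathbb{P}_k(\mathbb{C}^{N\times N})$ is the vector space of matrix polynomials $Q(z)=\sum_{j=0}^k z^jA_j$, $A_j\in\mathbb{C}^{N\times N}$. $Q$ is regular if $\det Q(z)\not\equiv0$, and skew-symmetric if all $A_j^T=-A_j$. For $M\in\{2,F\}$, $|||Q|||_M:=\left(\sum_{j=0}^k\|A_j\|_M^2\right)^{1/2}$ with $\|\cdot\|_F$ Frobenius and $\|\cdot\|_2$ spectral norm. For $Q\in\mathbb{P}_k(\mathbb{C}^{N\times N})$ regular, $\lambda\in\mathbb{C}$, $u\in\mathbb{C}^N\setminus\{0\}$: $\eta(\lambda,u,Q):=\inf\{|||\Delta Q|||_M:\Delta Q\in\mathbb{P}_k(\mathbb{C}^{N\times N}),\ Q(\lambda)u+\Delta Q(\lambda)u=0\}=\|Q(\lambda)u\|_2/(\|u\|_2\|[1,\lambda,\ldots,\lambda^k]^T\|_2)$ (the same for $M=2,F$), and for a structure class $\mathbb{S}\subset\mathbb{P}_k(\mathbb{C}^{N\times N})$ with $Q\in\mathbb{S}$, $\eta_M^{\mathbb{S}}(\lambda,u,Q):=\inf\{|||\Delta Q|||_M:\Delta Q\in\mathbb{S},\ Q(\lambda)u+\Delta Q(\lambda)u=0\}$. $\mathbb{L}_1(P)$ is the set of pencils $L(z)=zX+Y$, $X,Y\in\mathbb{C}^{mn\times mn}$, for which there is $v\in\mathbb{C}^m$ (the right ansatz vector of $L$) with $L(z)\,([z^{m-1},z^{m-2},\ldots,1]^T\otimes I_n)=v\otimes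 P(z)$ for all $z$; $\otimes$ is the Kronecker product. $L$ is a linearization of $P$ if there are unimodular matrix polynomials $E,F$ with $E(z)L(z)F(z)=\mathrm{diag}(P(z),I_{(m-1)n})$. The pencil $L$ is viewed as an element of $\mathbb{P}_1(\mathbb{C}^{mn\times mn})$, and $\eta(\lambda,\cdot,L;v)$, $\eta_M^{\mathbb{S}}(\lambda,\cdot,L;v)$ are its (structured) backward errors, the $v$ only recording the ansatz vector. *)

theory Defs
  imports "HOL-Analysis.Analysis" "HOL-Computational_Algebra.Polynomial"
begin

text \<open>
  Matrix polynomials are matrices with polynomial entries; the size \<open>N\<close> is \<open>CARD('n)\<close> for a
  finite index type \<open>'n\<close>. In \<open>\<complex>\<^sup>m \<otimes> \<complex>\<^sup>n\<close> the index type is \<open>'m \<times> 'n\<close>, the first component being the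
  block index. Only the block index is ordered (it carries the exponents of \<open>\<Lambda>\<close>); finite linear
  orders of every size \<open>m \<ge> 1\<close> exist as types, e.g. the numeral types.
\<close>

definition mcoeff :: "complex poly^'n^'n \<Rightarrow> nat \<Rightarrow> complex^'n^'n" where
  "mcoeff Q j = (\<chi> a b. coeff (Q $ a $ b) j)"

definition meval :: "complex poly^'n^'n \<Rightarrow> complex \<Rightarrow> complex^'n^'n" where
  "meval Q z = (\<chi> a b. poly (Q $ a $ b) z)"

definition matpolys :: "nat \<Rightarrow> (complex poly^'n^'n) set" where
  "matpolys k = {Q. \<forall>a b. degree (Q $ a $ b) \<le> k}"

definition regular :: "complex poly^'n^'n \<Rightarrow> bool" where
  "regular Q \<longleftrightarrow> (\<exists>z. det (meval Q z) \<noteq> 0)"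

definition skew_matpolys :: "nat \<Rightarrow> (complex poly^'n^'n) set" where
  "skew_matpolys k = {Q \<in> matpolys k. \<forall>j. transpose (mcoeff Q j) = - mcoeff Q j}"

datatype norm_kind = Spectral | Frobenius

text \<open>
  The library norm on \<open>complex^'n\<close> is the Euclidean one, so the operator norm \<^term>\<open>onorm\<close> is the
  spectral norm; the library norm on \<open>complex^'n^'n\<close> is the Euclidean norm of the entries, i.e. the
  Frobenius norm.
\<close>

fun mnorm :: "norm_kind \<Rightarrow> complex^'n^'n \<Rightarrow> real" where
  "mnorm Spectral A = onorm (\<lambda>w. A *v w)"
| "mnorm Frobenius A = norm A"

definition mpnorm :: "norm_kind \<Rightarrow> nat \<Rightarrow> complex poly^'n^'n \<Rightarrow> real" where
  "mpnorm M k Q = sqrt (\<Sum>j\<le>k. (mnorm M (mcoeff Q j))\<^sup>2)"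

definition backward_error ::
    "norm_kind \<Rightarrow> nat \<Rightarrow> complex \<Rightarrow> complex^'n \<Rightarrow> complex poly^'n^'n \<Rightarrow> real" where
  "backward_error M k \<mu> u Q =
     Inf {mpnorm M k D | D. D \<in> matpolys k \<and> meval Q \<mu> *v u + meval D \<mu> *v u = 0}"

text \<open>
  \<open>S\<close> is a subset of \<^term>\<open>matpolys k\<close> containing \<open>Q\<close>. The infimum is over a nonempty set
  whenever \<open>- Q \<in> S\<close>, as for skew-symmetric \<open>Q\<close>.
\<close>

definition structured_backward_error ::
    "norm_kind \<Rightarrow> nat \<Rightarrow> (complex poly^'n^'n) set \<Rightarrow> complex \<Rightarrow> complex^'n \<Rightarrow> complex poly^'n^'n \<Rightarrow> real"
  where
  "structured_backward_error M k S \<mu> u Q =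
     Inf {mpnorm M k D | D. D \<in> S \<and> meval Q \<mu> *v u + meval D \<mu> *v u = 0}"

definition kron_vec :: "complex^'m \<Rightarrow> complex^'n \<Rightarrow> complex^('m \<times> 'n)" where
  "kron_vec v w = (\<chi> p. v $ fst p * w $ snd p)"

text \<open>The Kronecker product of a column vector and a matrix.\<close>

definition kron_vec_mat :: "complex^'m \<Rightarrow> complex^'c^'r \<Rightarrow> complex^'c^('m \<times> 'r)" where
  "kron_vec_mat v A = (\<chi> p b. v $ fst p * A $ snd p $ b)"

text \<open>
  The vector \<open>[z\<^sup>m\<^sup>-\<^sup>1, \<dots>, z, 1]\<close>: the exponent at index \<open>i\<close> is the number of indices after \<open>i\<close>.
\<close>

definition Lam :: "complex \<Rightarrow> complex^('m::{finite,linorder})" where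
  "Lam z = (\<chi> i. z ^ card {j. i < j})"

definition right_ansatz_vector ::
    "complex poly^'n^'n \<Rightarrow> complex poly^('m::{finite,linorder} \<times> 'n)^('m \<times> 'n) \<Rightarrow> complex^('m::{finite,linorder}) \<Rightarrow> bool"
  where
  "right_ansatz_vector P L v \<longleftrightarrow>
     (\<forall>z. meval L z ** kron_vec_mat (Lam z) (mat 1) = kron_vec_mat v (meval P z))"

definition L1_space ::
    "complex poly^'n^'n \<Rightarrow> (complex poly^('m::{finite,linorder} \<times> 'n)^('m \<times> 'n)) set" where
  "L1_space P = {L \<in> matpolys 1. \<exists>v. right_ansatz_vector P L v}"

definition unimodular :: "complex poly^'n^'n \<Rightarrow> bool" where
  "unimodular E \<longleftrightarrow> (\<exists>c. c \<noteq> 0 \<and> det E = [:c:])"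

text \<open>The block diagonal matrix with \<open>P\<close> in the first block and the identity in all others.\<close>

definition diag_extend ::
    "complex poly^'n^'n \<Rightarrow> complex poly^('m::{finite,linorder} \<times> 'n)^('m \<times> 'n)" where
  "diag_extend P = (\<chi> p q.
     if fst p = Min UNIV \<and> fst q = Min UNIV then P $ snd p $ snd q
     else if p = q then 1 else 0)"

definition is_linearization ::
    "complex poly^'n^'n \<Rightarrow> complex poly^('m::{finite,linorder} \<times> 'n)^('m \<times> 'n) \<Rightarrow> bool" where
  "is_linearization P L \<longleftrightarrow>
     (\<exists>E F. unimodular E \<and> unimodular F \<and> E ** L ** F = diag_extend P)"

end

theory Submission
  imports Defs
begin

text \<open>
  Writing \<open>\<Lambda>\<^sub>k\<close> for the vector of powers up to \<open>\<mu>^k\<close>, Cauchy-Schwarz over the coefficients gives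
  \<open>\<eta>(\<mu>, u, Q) = \<parallel>Q(\<mu>)u\<parallel> / (\<parallel>u\<parallel> \<parallel>\<Lambda>\<^sub>k\<parallel>)\<close>, attained by a rank-one perturbation. For skew-symmetric
  \<open>Q\<close> the vector \<open>r = - Q(\<mu>)u\<close> satisfies \<open>u\<^sup>T r = 0\<close>, so the matrix \<open>(r u\<^sup>* - (r u\<^sup>*)\<^sup>T) / \<parallel>u\<parallel>\<^sup>2\<close> is
  skew-symmetric and maps \<open>u\<close> to \<open>r\<close>; its norm is \<open>\<parallel>r\<parallel> / \<parallel>u\<parallel>\<close> (spectral) or \<open>sqrt 2\<close> times this
  (Frobenius), which is least possible. The structured error is thus a multiple of the
  unstructured one by a factor independent of \<open>Q\<close> and of the size, and both ratios equal
  \<open>\<parallel>\<Lambda>\<^sub>m\<parallel> / (\<parallel>\<Lambda>\<^sub>m\<^sub>-\<^sub>1\<parallel> \<parallel>\<Lambda>\<^sub>1\<parallel>)\<close> because \<open>L(\<mu>)(\<Lambda> \<otimes> x) = v \<otimes> P(\<mu>)x\<close>. The bounds on this number come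
  from \<open>a^j + a^(m-j) \<le> 1 + a^m\<close> with \<open>a = \<bar>\<mu>\<bar>\<^sup>2\<close>.
\<close>

section \<open>Hermitian sums and Euclidean norms of vectors\<close>

lemma norm_sq_vec: "(norm (x :: complex^'n))\<^sup>2 = (\<Sum>i\<in>UNIV. (cmod (x $ i))\<^sup>2)"
  by (simp add: norm_vec_def L2_set_def sum_nonneg)

lemma inner_complex_vec: "(x :: complex^'n) \<bullet> y = Re (\<Sum>i\<in>UNIV. cnj (x $ i) * y $ i)"
  by (simp add: inner_vec_def inner_complex_def Re_sum)

lemma norm_scalar_mult_vec: "norm (c *s (x :: complex^'n)) = cmod c * norm x"
  by (simp add: norm_vec_def norm_mult L2_set_right_distrib)

lemma cnj_mult_self: "cnj z * z = complex_of_real ((cmod z)\<^sup>2)"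
  using complex_norm_square [of z] by (simp only: mult.commute)

lemma complex_of_real_norm_sq_vec:
  "(\<Sum>i\<in>UNIV. cnj (x $ i) * x $ i) = complex_of_real ((norm (x :: complex^'n))\<^sup>2)"
  by (simp only: norm_sq_vec of_real_sum cnj_mult_self)

definition cnj_vec :: "complex^'n \<Rightarrow> complex^'n" where
  "cnj_vec u = (\<chi> i. cnj (u $ i))"

lemma cnj_vec_nth [simp]: "cnj_vec u $ i = cnj (u $ i)"
  by (simp add: cnj_vec_def)

lemma norm_cnj_vec [simp]: "norm (cnj_vec u) = norm u"
  by (simp add: norm_vec_def)

text \<open>Pythagoras. Hermitian orthogonality is assumed because a vanishing real inner product
  would not survive the complex scalars \<open>a\<close> and \<open>b\<close>.\<close>

lemma norm_sq_combination:
  assumes "(\<Sum>i\<in>UNIV. cnj (x $ i) * y $ i) = 0"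
  shows "(norm (a *s x + b *s (y :: complex^'n)))\<^sup>2 = (cmod a * norm x)\<^sup>2 + (cmod b * norm y)\<^sup>2"
proof -
  have "(\<Sum>i\<in>UNIV. cnj ((a *s x) $ i) * (b *s y) $ i)
      = cnj a * b * (\<Sum>i\<in>UNIV. cnj (x $ i) * y $ i)"
    by (simp add: sum_distrib_left mult_ac)
  then have "(a *s x) \<bullet> (b *s y) = 0"
    by (simp only: inner_complex_vec assms) simp
  then show ?thesis
    using dot_norm [of "a *s x" "b *s y"] by (simp add: norm_scalar_mult_vec)
qed

section \<open>Spectral and Frobenius norms of matrices\<close>

lemma matrix_vector_mult_norm_le:
  "norm ((A :: complex^'n^'m) *v u) \<le> norm A * norm u"
proof -
  have "cmod ((A *v u) $ a) \<le> norm (A $ a) * norm u" for a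
  proof -
    have "cmod ((A *v u) $ a) \<le> (\<Sum>b\<in>UNIV. \<bar>cmod (A $ a $ b)\<bar> * \<bar>cmod (u $ b)\<bar>)"
      unfolding matrix_vector_mult_def by (auto intro!: sum_norm_le simp: norm_mult)
    also have "\<dots> \<le> norm (A $ a) * norm u"
      unfolding norm_vec_def by (rule L2_set_mult_ineq)
    finally show ?thesis .
  qed
  then have "norm (A *v u) \<le> L2_set (\<lambda>a. norm (A $ a) * norm u) UNIV"
    unfolding norm_vec_def [of "A *v u"] by (intro L2_set_mono) auto
  also have "\<dots> = norm A * norm u"
    by (simp add: norm_vec_def [of A] L2_set_left_distrib)
  finally show ?thesis .
qed

lemma mnorm_nonneg: "0 \<le> mnorm M A"
  by (cases M) (simp_all add: onorm_pos_le)

lemma norm_matrix_vector_mult_le_mnorm: "norm (A *v u) \<le> mnorm M A * norm u"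
  by (cases M) (simp_all add: onorm matrix_vector_mult_norm_le)

lemma mnorm_le_Frobenius: "mnorm M A \<le> norm A"
  by (cases M) (auto intro: onorm_bound matrix_vector_mult_norm_le)

definition cscale :: "complex \<Rightarrow> complex^'n^'m \<Rightarrow> complex^'n^'m" where
  "cscale c A = (\<chi> i j. c * A $ i $ j)"

lemma cscale_mult_vec: "cscale c A *v u = c *s (A *v u)"
  by (simp add: cscale_def vec_eq_iff matrix_vector_mult_def sum_distrib_left mult_ac)

lemma norm_cscale: "norm (cscale c A) = cmod c * norm A"
proof -
  have "norm (cscale c A $ i) = cmod c * norm (A $ i)" for i
    by (simp add: norm_scalar_mult_vec [symmetric] cscale_def vector_scalar_mult_def)
  then show ?thesis
    by (simp add: norm_vec_def [of A] norm_vec_def [of "cscale c A"] L2_set_right_distrib)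
qed

lemma mnorm_cscale_le: "mnorm M (cscale c A) \<le> cmod c * mnorm M A"
proof (cases M)
  case Spectral
  have "norm (cscale c A *v w) \<le> cmod c * mnorm Spectral A * norm w" for w
    using norm_matrix_vector_mult_le_mnorm [of A w Spectral]
    by (simp add: cscale_mult_vec norm_scalar_mult_vec mult_left_mono mult.assoc del: mnorm.simps)
  then have "onorm ((*v) (cscale c A)) \<le> cmod c * mnorm Spectral A"
    by (intro onorm_bound) (simp_all add: mnorm_nonneg del: mnorm.simps)
  then show ?thesis
    using Spectral by simp
qed (simp add: norm_cscale)


section \<open>Minimal matrices, skew-symmetric or arbitrary, with one prescribed image\<close>

lemma skew_nth:
  assumes "transpose A = - A"
  shows "A $ j $ i = - A $ i $ j"
  using arg_cong [OF assms, of "\<lambda>B. B $ i $ j"] by (simp add: transpose_def)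

lemma skewI:
  assumes "\<And>i j. A $ j $ i = - A $ i $ j"
  shows "transpose A = - A"
proof -
  have "transpose A $ i $ j = (- A) $ i $ j" for i j
    using assms [of j i] by (simp add: transpose_def)
  then show ?thesis
    by (simp only: vec_eq_iff) simp
qed

lemma transpose_cscale_skew:
  assumes "transpose A = - A"
  shows "transpose (cscale c A) = - cscale c A"
proof (rule skewI)
  show "cscale c A $ j $ i = - cscale c A $ i $ j" for i j
    using skew_nth [OF assms, of j i] by (simp add: cscale_def)
qed

text \<open>Exchanging the summation indices turns the bilinear form \<open>u^T A u\<close> into its
  own negative. This is also the solvability condition of the structured problem.\<close>

lemma skew_sum_zero:
  assumes "transpose A = - (A :: complex^'n^'n)"
  shows "(\<Sum>i\<in>UNIV. u $ i * (A *v u) $ i) = 0"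
proof -
  have skew: "A $ j $ i = - A $ i $ j" for i j
    using assms by (rule skew_nth)
  define T where "T = (\<Sum>i\<in>UNIV. \<Sum>j\<in>UNIV. u $ i * (A $ i $ j * u $ j))"
  have "T = (\<Sum>i\<in>UNIV. \<Sum>j\<in>UNIV. u $ j * (A $ j $ i * u $ i))"
    unfolding T_def by (rule sum.swap)
  also have "\<dots> = - T"
    unfolding T_def sum_negf [symmetric]
    by (intro sum.cong refl, subst skew) (simp add: mult_ac)
  finally have "T = 0"
    by simp
  then show ?thesis
    by (simp add: T_def matrix_vector_mult_def sum_distrib_left)
qed

text \<open>With \<open>R\<close> the product of \<open>r\<close> and the adjoint of
  \<open>u\<close>, this is \<open>R - R^T\<close>; the division by \<open>(norm u)\<^sup>2\<close>
  is left to \<open>ex_skew_minimal\<close>.\<close>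

definition skew_outer :: "complex^'n \<Rightarrow> complex^'n \<Rightarrow> complex^'n^'n" where
  "skew_outer r u = (\<chi> i j. r $ i * cnj (u $ j) - cnj (u $ i) * r $ j)"

lemma transpose_skew_outer: "transpose (skew_outer r u) = - skew_outer r u"
  by (simp add: transpose_def skew_outer_def vec_eq_iff)

lemma skew_outer_mult_vec:
  "skew_outer r u *v w
    = (\<Sum>j\<in>UNIV. cnj (u $ j) * w $ j) *s r + (- (\<Sum>j\<in>UNIV. r $ j * w $ j)) *s cnj_vec u"
  by (simp add: vec_eq_iff skew_outer_def matrix_vector_mult_def left_diff_distrib
      right_diff_distrib sum_subtractf sum_distrib_left sum_distrib_right mult_ac)

text \<open>The two rank-one halves of \<open>skew_outer r u\<close> contribute equally: the minus
  sign of the second cancels against the skewness of \<open>A\<close>. Taking \<open>A\<close> to be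
  \<open>skew_outer r u\<close> yields its Frobenius norm; for general \<open>A\<close>,
  Cauchy-Schwarz then yields a lower bound on \<open>norm A\<close>.\<close>

lemma inner_skew_outer:
  assumes "transpose A = - (A :: complex^'n^'n)"
  shows "A \<bullet> skew_outer r u = 2 * ((A *v u) \<bullet> r)"
proof -
  have skew: "A $ j $ i = - A $ i $ j" for i j
    using assms by (rule skew_nth)
  define T where "T = (\<Sum>i\<in>UNIV. \<Sum>j\<in>UNIV. cnj (A $ i $ j) * cnj (u $ j) * r $ i)"
  have "(\<Sum>i\<in>UNIV. \<Sum>j\<in>UNIV. cnj (A $ i $ j) * cnj (u $ i) * r $ j)
      = (\<Sum>i\<in>UNIV. \<Sum>j\<in>UNIV. cnj (A $ j $ i) * cnj (u $ j) * r $ i)"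
    by (rule sum.swap)
  also have "\<dots> = - T"
    unfolding T_def sum_negf [symmetric]
    by (intro sum.cong refl, subst skew) simp
  finally have *: "(\<Sum>i\<in>UNIV. \<Sum>j\<in>UNIV. cnj (A $ i $ j) * cnj (u $ i) * r $ j) = - T" .
  have "A \<bullet> skew_outer r u
      = Re (\<Sum>i\<in>UNIV. \<Sum>j\<in>UNIV. cnj (A $ i $ j) * skew_outer r u $ i $ j)"
    by (simp only: inner_vec_def [of A] inner_complex_vec Re_sum)
  also have "(\<Sum>i\<in>UNIV. \<Sum>j\<in>UNIV. cnj (A $ i $ j) * skew_outer r u $ i $ j) = T - (- T)"
    unfolding * [symmetric] unfolding T_def
    by (simp add: skew_outer_def right_diff_distrib sum_subtractf mult_ac)
  also have "Re (T - (- T)) = 2 * Re T"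
    by simp
  also have "Re T = (A *v u) \<bullet> r"
    by (simp add: T_def inner_complex_vec matrix_vector_mult_def sum_distrib_right)
  finally show ?thesis .
qed

text \<open>The ratio of the structured to the unstructured backward error: a minimal skew-symmetric
  perturbation has rank two with equal singular values.\<close>

fun skew_factor :: "norm_kind \<Rightarrow> real" where
  "skew_factor Spectral = 1"
| "skew_factor Frobenius = sqrt 2"

lemma skew_factor_pos: "0 < skew_factor M"
  by (cases M) simp_all

lemma norm_skew_outer:
  assumes "(\<Sum>i\<in>UNIV. u $ i * r $ i) = 0"
  shows "norm (skew_outer r u) = sqrt 2 * norm u * norm r"
proof -
  have "skew_outer r u *v u = complex_of_real ((norm u)\<^sup>2) *s r"
    using assms by (simp add: skew_outer_mult_vec complex_of_real_norm_sq_vec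
        mult.commute [of "r $ _"])
  also have "\<dots> = (norm u)\<^sup>2 *\<^sub>R r"
    by (simp add: vec_eq_iff scaleR_conv_of_real [where 'a = complex] del: of_real_power)
  finally have "(norm (skew_outer r u))\<^sup>2 = (sqrt 2 * norm u * norm r)\<^sup>2"
    by (simp add: power2_norm_eq_inner inner_skew_outer transpose_skew_outer
        power_mult_distrib)
  then show ?thesis
    by (rule power2_eq_imp_eq) auto
qed

text \<open>Under the assumption, \<open>r\<close> is orthogonal to the conjugate of
  \<open>u\<close>, and \<open>u\<close> to the conjugate of \<open>r\<close>. For nonzero
  \<open>u\<close> and \<open>r\<close> both nonzero singular values are therefore
  \<open>norm u * norm r\<close>.\<close>

lemma onorm_skew_outer_le:
  assumes "(\<Sum>i\<in>UNIV. u $ i * r $ i) = 0"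
  shows "onorm ((*v) (skew_outer r u)) \<le> norm u * norm r"
proof (rule onorm_bound)
  fix w
  define a where "a = (\<Sum>j\<in>UNIV. cnj (u $ j) * w $ j)"
  define b where "b = (\<Sum>j\<in>UNIV. r $ j * w $ j)"
  define S where "S = norm (skew_outer r u *v w)"
  have "(\<Sum>i\<in>UNIV. cnj (u $ i) * cnj (r $ i)) = cnj (\<Sum>i\<in>UNIV. u $ i * r $ i)"
    by simp
  then have orth: "(\<Sum>i\<in>UNIV. cnj (u $ i) * cnj (r $ i)) = 0"
      "(\<Sum>i\<in>UNIV. cnj (r $ i) * cnj (u $ i)) = 0"
    using assms by (simp_all add: mult.commute [of "cnj (r $ _)"])
  have S: "S\<^sup>2 = (cmod a * norm r)\<^sup>2 + (cmod b * norm u)\<^sup>2"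
    unfolding S_def skew_outer_mult_vec a_def [symmetric] b_def [symmetric]
    by (subst norm_sq_combination) (simp_all add: orth)
  \<comment> \<open>\<open>q\<close> is the adjoint of \<open>skew_outer r u\<close> applied to
    \<open>skew_outer r u *v w\<close>; orthogonality has removed the cross terms. Hence
    \<open>S\<^sup>2 = q \<bullet> w\<close>, to which Cauchy-Schwarz applies.\<close>
  define q where "q = (complex_of_real ((norm r)\<^sup>2) * a) *s u
      + (complex_of_real ((norm u)\<^sup>2) * b) *s cnj_vec r"
  have "(norm q)\<^sup>2 = (norm u * norm r * S)\<^sup>2"
    unfolding q_def power_mult_distrib S
    by (subst norm_sq_combination)
      (simp_all add: orth norm_mult norm_power algebra_simps power2_eq_square)
  then have q: "norm q = norm u * norm r * S"
    by (rule power2_eq_imp_eq) (auto simp: S_def)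
  have "(\<Sum>i\<in>UNIV. cnj (q $ i) * w $ i)
      = (\<Sum>i\<in>UNIV. complex_of_real ((norm r)\<^sup>2) * cnj a * (cnj (u $ i) * w $ i)
          + complex_of_real ((norm u)\<^sup>2) * cnj b * (r $ i * w $ i))"
    by (simp add: q_def algebra_simps)
  also have "\<dots>
      = complex_of_real ((norm r)\<^sup>2) * (cnj a * a) + complex_of_real ((norm u)\<^sup>2) * (cnj b * b)"
    unfolding sum.distrib sum_distrib_left [symmetric] a_def [symmetric] b_def [symmetric]
    by (simp only: mult.assoc)
  also have "\<dots> = complex_of_real (S\<^sup>2)"
    unfolding cnj_mult_self S by (simp add: power_mult_distrib mult.commute)
  finally have "S\<^sup>2 = q \<bullet> w"
    by (simp add: inner_complex_vec)
  also have "\<dots> \<le> norm q * norm w"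
    by (rule norm_cauchy_schwarz)
  finally have "S * S \<le> norm u * norm r * norm w * S"
    by (simp add: q power2_eq_square mult_ac)
  moreover have "0 \<le> S"
    by (simp add: S_def)
  ultimately show "norm (skew_outer r u *v w) \<le> norm u * norm r * norm w"
    unfolding S_def [symmetric] by (cases "S = 0") (auto dest: mult_right_le_imp_le)
qed simp

lemma mnorm_skew_outer_le:
  assumes "(\<Sum>i\<in>UNIV. u $ i * r $ i) = 0"
  shows "mnorm M (skew_outer r u) \<le> skew_factor M * (norm u * norm r)"
  by (cases M) (simp_all add: onorm_skew_outer_le norm_skew_outer assms)

text \<open>Nonzero singular values of a skew-symmetric matrix come in equal pairs, which explains
  \<open>sqrt 2\<close> in the Frobenius case. Instead of a decomposition, the proof pairs
  \<open>A\<close> with \<open>skew_outer (A *v u) u\<close>, whose norm is known because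
  \<open>u^T A u = 0\<close>.\<close>

lemma skew_factor_le_mnorm:
  assumes "transpose A = - A"
  shows "skew_factor M * norm (A *v u) \<le> mnorm M A * norm u"
proof (cases M)
  case Spectral
  then show ?thesis
    using norm_matrix_vector_mult_le_mnorm [of A u M] by simp
next
  case Frobenius
  define r where "r = A *v u"
  have "2 * (norm r)\<^sup>2 = A \<bullet> skew_outer r u"
    by (simp add: inner_skew_outer assms r_def power2_norm_eq_inner)
  also have "\<dots> \<le> norm A * norm (skew_outer r u)"
    by (rule norm_cauchy_schwarz)
  also have "\<dots> = sqrt 2 * (norm A * norm u * norm r)"
    using skew_sum_zero [OF assms, of u] by (simp add: norm_skew_outer r_def)
  \<comment> \<open>The factor 2 is split so that the common factor \<open>sqrt 2 * norm r\<close>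
    cancels.\<close>
  finally have "sqrt 2 * norm r * (sqrt 2 * norm r) \<le> norm A * norm u * (sqrt 2 * norm r)"
    by (simp add: power2_eq_square mult_ac)
  then show ?thesis
    using Frobenius by (cases "norm r = 0") (auto simp: r_def dest: mult_right_le_imp_le)
qed

lemma ex_skew_minimal:
  assumes "(\<Sum>i\<in>UNIV. u $ i * r $ i) = 0" and "u \<noteq> 0"
  obtains B where "transpose B = - B" "B *v u = r"
    "mnorm M B * norm u \<le> skew_factor M * norm r"
proof
  define c where "c = complex_of_real (1 / (norm u)\<^sup>2)"
  let ?B = "cscale c (skew_outer r u)"
  show "transpose ?B = - ?B"
    by (rule transpose_cscale_skew [OF transpose_skew_outer])
  show "?B *v u = r"
    using assms by (simp add: cscale_mult_vec skew_outer_mult_vec complex_of_real_norm_sq_vec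
        c_def mult.commute [of "r $ _"])
  have "mnorm M ?B \<le> cmod c * mnorm M (skew_outer r u)"
    by (rule mnorm_cscale_le)
  also have "\<dots> \<le> cmod c * (skew_factor M * (norm u * norm r))"
    by (intro mult_left_mono mnorm_skew_outer_le assms) auto
  finally have "mnorm M ?B * norm u \<le> cmod c * (skew_factor M * (norm u * norm r)) * norm u"
    by (rule mult_right_mono) simp
  then show "mnorm M ?B * norm u \<le> skew_factor M * norm r"
    using assms(2) by (simp add: c_def norm_divide norm_mult power2_eq_square)
qed

text \<open>The rank-one witness has Frobenius norm \<open>norm r / norm u\<close>, which also
  bounds its spectral norm, so it serves both kinds of norm.\<close>

lemma ex_minimal:
  fixes u r :: "complex^'n"
  assumes "u \<noteq> 0"
  obtains B where "B *v u = r" "mnorm M B * norm u \<le> norm r"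
proof
  define c where "c = complex_of_real (1 / (norm u)\<^sup>2)"
  define B :: "complex^'n^'n" where "B = (\<chi> i j. c * (r $ i * cnj (u $ j)))"
  have "B *v u = (c * (\<Sum>j\<in>UNIV. cnj (u $ j) * u $ j)) *s r"
    by (simp add: B_def vec_eq_iff matrix_vector_mult_def sum_distrib_left sum_distrib_right mult_ac)
  then show "B *v u = r"
    using assms by (simp add: complex_of_real_norm_sq_vec c_def)
  have "B $ i = (c * r $ i) *s cnj_vec u" for i
    by (simp add: B_def vec_eq_iff)
  then have "norm B = cmod c * norm r * norm u"
    by (simp add: norm_vec_def [of B] norm_vec_def [of r] norm_scalar_mult_vec norm_mult
        L2_set_left_distrib L2_set_right_distrib)
  then have "norm B * norm u = norm r"
    using assms by (simp add: c_def norm_divide norm_mult power2_eq_square)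
  then show "mnorm M B * norm u \<le> norm r"
    using mnorm_le_Frobenius [of M B] by (metis mult_right_mono norm_ge_zero)
qed


section \<open>Evaluation and norms of matrix polynomials\<close>

lemma meval_mult_vec:
  assumes "Q \<in> matpolys k"
  shows "meval Q \<mu> *v u = (\<Sum>j\<le>k. \<mu> ^ j *s (mcoeff Q j *v u))"
proof -
  have "poly (Q $ a $ b) \<mu> = (\<Sum>j\<le>k. \<mu> ^ j * coeff (Q $ a $ b) j)" for a b
  proof -
    have "degree (Q $ a $ b) \<le> k"
      using assms by (simp add: matpolys_def)
    then have "poly (Q $ a $ b) \<mu> = poly (\<Sum>j\<le>k. monom (coeff (Q $ a $ b) j) j) \<mu>"
      by (simp add: poly_as_sum_of_monoms')
    then show ?thesis
      by (simp add: poly_sum poly_monom mult.commute)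
  qed
  moreover have "(\<Sum>b\<in>UNIV. (\<Sum>j\<le>k. \<mu> ^ j * coeff (Q $ a $ b) j) * u $ b)
      = (\<Sum>j\<le>k. \<Sum>b\<in>UNIV. \<mu> ^ j * coeff (Q $ a $ b) j * u $ b)" for a
    unfolding sum_distrib_right by (rule sum.swap)
  ultimately show ?thesis
    by (simp add: vec_eq_iff meval_def mcoeff_def matrix_vector_mult_def sum_distrib_left mult.assoc)
qed

lemma transpose_meval:
  assumes "Q \<in> skew_matpolys k"
  shows "transpose (meval Q \<mu>) = - meval Q \<mu>"
proof -
  have "coeff (Q $ b $ a) j = - coeff (Q $ a $ b) j" for a b j
    using skew_nth [of "mcoeff Q j" b a] assms by (auto simp: skew_matpolys_def mcoeff_def)
  then have skew: "Q $ b $ a = - Q $ a $ b" for a b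
    by (metis poly_eqI coeff_minus)
  show ?thesis
  proof (rule skewI)
    show "meval Q \<mu> $ j $ i = - meval Q \<mu> $ i $ j" for i j
      using arg_cong [OF skew [of j i], of "\<lambda>p. poly p \<mu>"] by (simp add: meval_def)
  qed
qed

text \<open>The Euclidean norm of \<open>[1, \<mu>, ..., \<mu>^k]\<close>; as
  \<open>0 ^ 0 = 1\<close>, it is positive at \<open>\<mu> = 0\<close> too.\<close>

definition pownorm :: "nat \<Rightarrow> complex \<Rightarrow> real" where
  "pownorm k \<mu> = L2_set (\<lambda>j. cmod \<mu> ^ j) {..k}"

lemma pownorm_sq: "(pownorm k \<mu>)\<^sup>2 = (\<Sum>j\<le>k. ((cmod \<mu>)\<^sup>2) ^ j)"
  by (simp add: pownorm_def L2_set_def sum_nonneg power_mult [symmetric] mult.commute)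

lemma pownorm_pos: "0 < pownorm k \<mu>"
proof -
  have "cmod \<mu> ^ 0 \<le> pownorm k \<mu>"
    unfolding pownorm_def by (rule member_le_L2_set) auto
  then show ?thesis
    by simp
qed

lemma mpnorm_eq_L2_set: "mpnorm M k Q = L2_set (\<lambda>j. mnorm M (mcoeff Q j)) {..k}"
  by (simp add: mpnorm_def L2_set_def)

text \<open>Triangle inequality over the coefficients, then Cauchy-Schwarz against the powers. The
  constant \<open>c\<close> will be 1 without structure and \<open>skew_factor M\<close> with
  it.\<close>

lemma mpnorm_ge:
  assumes D: "D \<in> matpolys k" and "0 \<le> c"
    and le: "\<And>j. c * norm (mcoeff D j *v u) \<le> mnorm M (mcoeff D j) * norm u"
  shows "c * norm (meval D \<mu> *v u) \<le> mpnorm M k D * (norm u * pownorm k \<mu>)"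
proof -
  have "norm (meval D \<mu> *v u) \<le> (\<Sum>j\<le>k. cmod \<mu> ^ j * norm (mcoeff D j *v u))"
    unfolding meval_mult_vec [OF D]
    by (rule sum_norm_le) (simp add: norm_scalar_mult_vec norm_power)
  then have "c * norm (meval D \<mu> *v u) \<le> c * (\<Sum>j\<le>k. cmod \<mu> ^ j * norm (mcoeff D j *v u))"
    using \<open>0 \<le> c\<close> by (rule mult_left_mono)
  also have "\<dots> = (\<Sum>j\<le>k. cmod \<mu> ^ j * (c * norm (mcoeff D j *v u)))"
    by (simp add: sum_distrib_left mult_ac)
  also have "\<dots> \<le> (\<Sum>j\<le>k. cmod \<mu> ^ j * (mnorm M (mcoeff D j) * norm u))"
    by (intro sum_mono mult_left_mono le) simp
  also have "\<dots> = (\<Sum>j\<le>k. \<bar>mnorm M (mcoeff D j)\<bar> * \<bar>cmod \<mu> ^ j\<bar>) * norm u"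
    by (simp add: sum_distrib_left sum_distrib_right mnorm_nonneg mult_ac)
  also have "\<dots> \<le> (mpnorm M k D * pownorm k \<mu>) * norm u"
    unfolding mpnorm_eq_L2_set pownorm_def
    by (intro mult_right_mono L2_set_mult_ineq) simp
  finally show ?thesis
    by (simp add: mult_ac)
qed

text \<open>The matrix polynomial of least norm with value \<open>B\<close> at \<open>\<mu>\<close> (equality in Cauchy-Schwarz).\<close>

definition minimal_lift :: "nat \<Rightarrow> complex \<Rightarrow> complex^'n^'n \<Rightarrow> complex poly^'n^'n" where
  "minimal_lift k \<mu> B =
     (\<chi> a b. \<Sum>j\<le>k. monom (cnj \<mu> ^ j / complex_of_real ((pownorm k \<mu>)\<^sup>2) * B $ a $ b) j)"

lemma mcoeff_minimal_lift:
  "mcoeff (minimal_lift k \<mu> B) j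
    = (if j \<le> k then cscale (cnj \<mu> ^ j / complex_of_real ((pownorm k \<mu>)\<^sup>2)) B else 0)"
  by (simp add: mcoeff_def minimal_lift_def cscale_def vec_eq_iff coeff_sum)

lemma minimal_lift_in_matpolys: "minimal_lift k \<mu> B \<in> matpolys k"
  by (auto simp: matpolys_def minimal_lift_def
      intro!: degree_sum_le order_trans [OF degree_monom_le])

lemma minimal_lift_in_skew_matpolys:
  assumes "transpose B = - B"
  shows "minimal_lift k \<mu> B \<in> skew_matpolys k"
  by (auto simp: skew_matpolys_def mcoeff_minimal_lift minimal_lift_in_matpolys
      transpose_cscale_skew [OF assms]) (simp add: transpose_def vec_eq_iff)

lemma meval_minimal_lift: "meval (minimal_lift k \<mu> B) \<mu> = B"
proof -
  have "(\<Sum>j\<le>k. cnj \<mu> ^ j / complex_of_real ((pownorm k \<mu>)\<^sup>2) * c * \<mu> ^ j) = c" for c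
  proof -
    have "(\<Sum>j\<le>k. cnj \<mu> ^ j / complex_of_real ((pownorm k \<mu>)\<^sup>2) * c * \<mu> ^ j)
        = (\<Sum>j\<le>k. (cnj \<mu> * \<mu>) ^ j) * (c / complex_of_real ((pownorm k \<mu>)\<^sup>2))"
      by (simp add: sum_distrib_left sum_divide_distrib power_mult_distrib mult_ac)
    also have "(\<Sum>j\<le>k. (cnj \<mu> * \<mu>) ^ j) = complex_of_real ((pownorm k \<mu>)\<^sup>2)"
      by (simp add: cnj_mult_self pownorm_sq)
    finally show ?thesis
      using pownorm_pos [of k \<mu>] by simp
  qed
  then show ?thesis
    by (simp add: meval_def minimal_lift_def vec_eq_iff poly_sum poly_monom)
qed

text \<open>The weights \<open>cnj \<mu> ^ j / (pownorm k \<mu>)\<^sup>2\<close> together have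
  Euclidean norm \<open>1 / pownorm k \<mu>\<close>.\<close>

lemma mpnorm_minimal_lift_le: "mpnorm M k (minimal_lift k \<mu> B) \<le> mnorm M B / pownorm k \<mu>"
proof -
  have "mnorm M (mcoeff (minimal_lift k \<mu> B) j)
      \<le> cmod \<mu> ^ j * (mnorm M B / (pownorm k \<mu>)\<^sup>2)" if "j \<le> k" for j
    using mnorm_cscale_le [of M "cnj \<mu> ^ j / complex_of_real ((pownorm k \<mu>)\<^sup>2)" B] that
    by (simp add: mcoeff_minimal_lift norm_divide norm_power)
  then have "mpnorm M k (minimal_lift k \<mu> B)
      \<le> L2_set (\<lambda>j. cmod \<mu> ^ j * (mnorm M B / (pownorm k \<mu>)\<^sup>2)) {..k}"
    unfolding mpnorm_eq_L2_set by (intro L2_set_mono) (auto simp: mnorm_nonneg)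
  also have "\<dots> = pownorm k \<mu> * (mnorm M B / (pownorm k \<mu>)\<^sup>2)"
    unfolding pownorm_def by (rule L2_set_left_distrib [symmetric]) (simp add: mnorm_nonneg)
  also have "\<dots> = mnorm M B / pownorm k \<mu>"
    by (simp add: power2_eq_square)
  finally show ?thesis .
qed

section \<open>Closed formulas for the backward errors\<close>

text \<open>Common source of both formulas below. By \<open>mpnorm_ge\<close>, assumption
  \<open>le\<close> makes the value a lower bound; the minimal lift of \<open>B\<close> attains it,
  so the infimum is a minimum.\<close>

lemma structured_backward_error_eq:
  assumes S: "S \<subseteq> matpolys k" and "u \<noteq> 0" and "0 \<le> c"
    and le: "\<And>D j. D \<in> S \<Longrightarrow> c * norm (mcoeff D j *v u) \<le> mnorm M (mcoeff D j) * norm u"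
    and B: "B *v u = - (meval Q \<mu> *v u)" "minimal_lift k \<mu> B \<in> S"
      "mnorm M B * norm u \<le> c * norm (meval Q \<mu> *v u)"
  shows "structured_backward_error M k S \<mu> u Q
    = c * norm (meval Q \<mu> *v u) / (norm u * pownorm k \<mu>)" (is "_ = ?e")
proof -
  have pos: "0 < norm u" "0 < pownorm k \<mu>"
    using \<open>u \<noteq> 0\<close> pownorm_pos by auto
  have ge: "?e \<le> mpnorm M k D" if "D \<in> S" "meval Q \<mu> *v u + meval D \<mu> *v u = 0" for D
  proof -
    have "meval D \<mu> *v u = - (meval Q \<mu> *v u)"
      using that(2) by (simp add: add_eq_0_iff)
    then have "c * norm (meval Q \<mu> *v u) \<le> mpnorm M k D * (norm u * pownorm k \<mu>)"
      using mpnorm_ge [of D k c u M \<mu>] that(1) S le \<open>0 \<le> c\<close> by auto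
    then show ?thesis
      using pos by (simp add: pos_divide_le_eq)
  qed
  have sol: "meval Q \<mu> *v u + meval (minimal_lift k \<mu> B) \<mu> *v u = 0"
    by (simp add: meval_minimal_lift B(1))
  have "mpnorm M k (minimal_lift k \<mu> B) \<le> ?e"
  proof -
    have "mnorm M B \<le> c * norm (meval Q \<mu> *v u) / norm u"
      using B(3) pos by (simp add: pos_le_divide_eq)
    then have "mnorm M B / pownorm k \<mu> \<le> c * norm (meval Q \<mu> *v u) / norm u / pownorm k \<mu>"
      using pos by (intro divide_right_mono) auto
    then show ?thesis
      using mpnorm_minimal_lift_le [of M k \<mu> B] by simp
  qed
  with ge [OF B(2) sol] have "mpnorm M k (minimal_lift k \<mu> B) = ?e"
    by simp
  with ge sol B(2) show ?thesis
    unfolding structured_backward_error_def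
    by (intro cInf_eq_minimum) (auto, metis)
qed

lemma backward_error_formula:
  assumes "u \<noteq> 0"
  shows "backward_error M k \<mu> u Q = norm (meval Q \<mu> *v u) / (norm u * pownorm k \<mu>)"
proof -
  obtain B where "B *v u = - (meval Q \<mu> *v u)" "mnorm M B * norm u \<le> norm (- (meval Q \<mu> *v u))"
    using ex_minimal [OF assms] by metis
  then have "structured_backward_error M k (matpolys k) \<mu> u Q
      = 1 * norm (meval Q \<mu> *v u) / (norm u * pownorm k \<mu>)"
    using assms
    by (intro structured_backward_error_eq)
      (auto simp: norm_matrix_vector_mult_le_mnorm minimal_lift_in_matpolys)
  then show ?thesis
    by (simp add: backward_error_def structured_backward_error_def)
qed

lemma skew_backward_error_formula:
  fixes Q :: "complex poly^'n^'n"
  assumes "Q \<in> skew_matpolys k" and "u \<noteq> 0"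
  shows "structured_backward_error M k (skew_matpolys k) \<mu> u Q
    = skew_factor M * norm (meval Q \<mu> *v u) / (norm u * pownorm k \<mu>)"
proof -
  have subset: "skew_matpolys k \<subseteq> matpolys k"
    and skew: "D \<in> skew_matpolys k \<Longrightarrow> transpose (mcoeff D j) = - mcoeff D j"
    for D :: "complex poly^'n^'n" and j
    by (auto simp: skew_matpolys_def)
  \<comment> \<open>The skewness of \<open>Q\<close> supplies the solvability condition of
    \<open>ex_skew_minimal\<close>.\<close>
  have "(\<Sum>i\<in>UNIV. u $ i * (- (meval Q \<mu> *v u)) $ i) = 0"
    using skew_sum_zero [OF transpose_meval [OF assms(1)], where u = u] by (simp add: sum_negf)
  then obtain B where B: "transpose B = - B" "B *v u = - (meval Q \<mu> *v u)"
      "mnorm M B * norm u \<le> skew_factor M * norm (- (meval Q \<mu> *v u))"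
    using ex_skew_minimal [OF _ assms(2)] by metis
  then show ?thesis
    by (intro structured_backward_error_eq [OF subset assms(2)] skew_factor_le_mnorm skew
        minimal_lift_in_skew_matpolys less_imp_le [OF skew_factor_pos]) auto
qed

section \<open>The vector of powers and the ansatz identity\<close>

text \<open>The exponents in \<open>Lam\<close> run once through \<open>0, ..., m - 1\<close>: the
  number of later indices strictly decreases, hence is injective, and surjectivity follows by
  counting.\<close>

lemma bij_betw_card_greater:
  "bij_betw (\<lambda>i :: 'm::{finite,linorder}. card {j. i < j}) UNIV {..<CARD('m)}"
proof -
  have mono: "card {k. j < k} < card {k. i < k}" if "i < j" for i j :: 'm
    using that by (intro psubset_card_mono) auto
  have inj: "inj (\<lambda>i :: 'm. card {j. i < j})"
    by (rule injI) (metis mono linorder_neqE less_irrefl)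
  have "card {j. i < j} < CARD('m)" for i :: 'm
    by (rule psubset_card_mono) auto
  then have "range (\<lambda>i :: 'm. card {j. i < j}) \<subseteq> {..<CARD('m)}"
    by auto
  moreover have "card (range (\<lambda>i :: 'm. card {j. i < j})) = CARD('m)"
    by (rule card_image) (rule inj)
  ultimately have "range (\<lambda>i :: 'm. card {j. i < j}) = {..<CARD('m)}"
    by (intro card_subset_eq) auto
  with inj show ?thesis
    by (simp add: bij_betw_def)
qed

lemma norm_Lam: "norm (Lam \<mu> :: complex^'m::{finite,linorder}) = pownorm (CARD('m) - 1) \<mu>"
proof -
  have "(norm (Lam \<mu> :: complex^'m::{finite,linorder}))\<^sup>2 = (\<Sum>i\<in>(UNIV :: 'm set). (cmod \<mu> ^ card {j. i < j})\<^sup>2)"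
    by (simp add: norm_sq_vec Lam_def norm_power)
  also have "\<dots> = (\<Sum>k<CARD('m). (cmod \<mu> ^ k)\<^sup>2)"
    by (rule sum.reindex_bij_betw [OF bij_betw_card_greater])
  also have "{..<CARD('m)} = {..CARD('m) - 1}"
    by (simp add: lessThan_Suc_atMost [symmetric])
  finally have "(norm (Lam \<mu> :: complex^'m::{finite,linorder}))\<^sup>2 = (pownorm (CARD('m) - 1) \<mu>)\<^sup>2"
    by (simp add: pownorm_sq power_mult [symmetric] mult.commute)
  then show ?thesis
    by (rule power2_eq_imp_eq) (auto intro: less_imp_le pownorm_pos)
qed

lemma norm_kron_vec: "norm (kron_vec a b) = norm a * norm b"
proof -
  have "(norm (kron_vec a b))\<^sup>2 = (norm a * norm b)\<^sup>2"
    unfolding norm_sq_vec power_mult_distrib sum_product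
    by (simp add: kron_vec_def norm_mult power_mult_distrib sum.cartesian_product split_beta)
  then show ?thesis
    by (rule power2_eq_imp_eq) auto
qed

lemma kron_vec_mat_mult_vec: "kron_vec_mat a A *v w = kron_vec a (A *v w)"
  by (simp add: vec_eq_iff kron_vec_mat_def kron_vec_def matrix_vector_mult_def
      sum_distrib_left mult.assoc)

text \<open>Applying both sides of the ansatz identity to \<open>x\<close> transfers the residual of
  \<open>P\<close> to \<open>L\<close>.\<close>

lemma right_ansatz_vector_mult_vec:
  assumes "right_ansatz_vector P L v"
  shows "meval L \<mu> *v kron_vec (Lam \<mu>) x = kron_vec v (meval P \<mu> *v x)"
  using arg_cong [OF assms [unfolded right_ansatz_vector_def, rule_format, of \<mu>],
      of "\<lambda>A. A *v x"]
  by (simp add: matrix_vector_mul_assoc [symmetric] kron_vec_mat_mult_vec)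

section \<open>Bounds for the ratio of power norms\<close>

text \<open>Multiplication by \<open>1 + a\<close> produces the inner powers twice, but
  \<open>1\<close> and \<open>a ^ m\<close> only once.\<close>

lemma geometric_product_eq:
  fixes a :: real
  assumes "1 \<le> m"
  shows "(\<Sum>j\<le>m - 1. a ^ j) * (\<Sum>j\<le>1. a ^ j) = 2 * (\<Sum>j\<le>m. a ^ j) - (1 + a ^ m)"
proof -
  obtain n where m: "m = Suc n"
    using assms by (cases m) auto
  have "1 + a * (\<Sum>j\<le>n. a ^ j) = (\<Sum>j\<le>n. a ^ j) + a ^ Suc n"
    using sum.atMost_Suc_shift [of "\<lambda>j. a ^ j" n] by (simp add: sum_distrib_left)
  then show ?thesis
    by (simp add: m algebra_simps)
qed

text \<open>The first bound keeps only the end terms, distinct since \<open>1 \<le> m\<close>; the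
  second pairs \<open>j\<close> with \<open>m - j\<close>.\<close>

lemma geometric_sum_bounds:
  fixes a :: real
  assumes "0 \<le> a" "1 \<le> m"
  shows "1 + a ^ m \<le> (\<Sum>j\<le>m. a ^ j)" and "2 * (\<Sum>j\<le>m. a ^ j) \<le> (real m + 1) * (1 + a ^ m)"
proof -
  have "(\<Sum>j\<in>{0, m}. a ^ j) \<le> (\<Sum>j\<le>m. a ^ j)"
    using assms by (intro sum_mono2) auto
  then show "1 + a ^ m \<le> (\<Sum>j\<le>m. a ^ j)"
    using assms by simp
  have "a ^ j + a ^ (m - j) \<le> 1 + a ^ m" if "j \<le> m" for j
  proof -
    \<comment> \<open>Both powers lie on the same side of 1, so the two factors never have opposite
      signs.\<close>
    have "0 \<le> (1 - a ^ j) * (1 - a ^ (m - j))"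
      using assms(1) by (cases "a \<le> 1") (auto simp: power_le_one one_le_power
          intro: mult_nonpos_nonpos)
    moreover have "a ^ j * a ^ (m - j) = a ^ m"
      using that by (simp flip: power_add)
    ultimately show ?thesis
      by (simp add: algebra_simps)
  qed
  then have "(\<Sum>j\<le>m. a ^ j + a ^ (m - j)) \<le> (\<Sum>j\<le>m. 1 + a ^ m)"
    by (intro sum_mono) auto
  moreover have "(\<Sum>j\<le>m. a ^ (m - j)) = (\<Sum>j\<le>m. a ^ j)"
    by (rule sum.reindex_bij_witness [of _ "\<lambda>j. m - j" "\<lambda>j. m - j"]) auto
  ultimately show "2 * (\<Sum>j\<le>m. a ^ j) \<le> (real m + 1) * (1 + a ^ m)"
    by (simp add: sum.distrib algebra_simps)
qed

text \<open>For numerator \<open>N\<close> and denominator \<open>D\<close>,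
  \<open>D^2 = 2 N^2 - (1 + a^m)\<close> with \<open>a = (cmod \<mu>)\<^sup>2\<close>. The two
  bounds on \<open>1 + a^m\<close> become \<open>N^2 \<le> D^2 \<le> 2m/(m+1) N^2\<close>.\<close>

lemma pownorm_ratio_bounds:
  assumes "1 \<le> m"
  shows "sqrt ((real m + 1) / (2 * real m)) \<le> pownorm m \<mu> / (pownorm (m - 1) \<mu> * pownorm 1 \<mu>)"
    and "pownorm m \<mu> / (pownorm (m - 1) \<mu> * pownorm 1 \<mu>) \<le> 1"
proof -
  let ?N = "pownorm m \<mu>" and ?D = "pownorm (m - 1) \<mu> * pownorm 1 \<mu>"
  have D: "0 < ?D" and N: "0 < ?N"
    by (simp_all add: pownorm_pos)
  define a where "a = (cmod \<mu>)\<^sup>2"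
  have D2: "?D\<^sup>2 = 2 * ?N\<^sup>2 - (1 + a ^ m)"
    using geometric_product_eq [OF assms, of a] by (simp only: power_mult_distrib pownorm_sq a_def)
  have bounds: "1 + a ^ m \<le> ?N\<^sup>2" "2 * ?N\<^sup>2 \<le> (real m + 1) * (1 + a ^ m)"
    using geometric_sum_bounds [of a m] assms by (simp_all add: pownorm_sq a_def)
  then have "?N\<^sup>2 \<le> ?D\<^sup>2"
    using D2 by simp
  then show "?N / ?D \<le> 1"
    using D by (simp add: power2_le_iff_abs_le)
  have "(real m + 1) * ?D\<^sup>2 \<le> 2 * real m * ?N\<^sup>2"
    unfolding D2 using bounds(2) by (simp add: algebra_simps)
  then have "(real m + 1) / (2 * real m) \<le> (?N / ?D)\<^sup>2"
    unfolding power_divide pos_le_divide_eq [OF zero_less_power [OF D]] times_divide_eq_left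
    using assms by (subst pos_divide_le_eq) (simp_all add: mult_ac)
  then show "sqrt ((real m + 1) / (2 * real m)) \<le> ?N / ?D"
    using D N by (intro real_le_lsqrt) auto
qed

theorem theorem4p4:
  fixes P :: "complex poly^'n^'n"
    and L :: "complex poly^('m::{finite,linorder} \<times> 'n)^('m \<times> 'n)"
    and v :: "complex^('m::{finite,linorder})" and x :: "complex^'n" and \<mu> :: complex
    and M M' :: norm_kind
  assumes "P \<in> skew_matpolys CARD('m)" and "regular P"
    and "L \<in> L1_space P" and "L \<in> skew_matpolys 1" and "is_linearization P L"
    and "right_ansatz_vector P L v" and "norm v = 1"
    and "norm x = 1" and "meval P \<mu> *v x \<noteq> 0"
  shows "let
      etaS_L = structured_backward_error M 1 (skew_matpolys 1) \<mu> (kron_vec (Lam \<mu>) x) L;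
      etaS_P = structured_backward_error M CARD('m) (skew_matpolys CARD('m)) \<mu> x P;
      eta_L = backward_error M' 1 \<mu> (kron_vec (Lam \<mu>) x) L;
      eta_P = backward_error M' CARD('m) \<mu> x P
    in sqrt ((real CARD('m) + 1) / (2 * real CARD('m))) \<le> etaS_L / etaS_P
      \<and> etaS_L / etaS_P = eta_L / eta_P
      \<and> eta_L / eta_P \<le> 1"
proof -
  define m where "m = CARD('m)"
  define \<rho> where "\<rho> = norm (meval P \<mu> *v x)"
  define u :: "complex^('m \<times> 'n)" where "u = kron_vec (Lam \<mu>) x"
  have m: "1 \<le> m"
    using zero_less_card_finite [where 'a = 'm] by (simp add: m_def Suc_le_eq)
  have \<rho>: "0 < \<rho>"
    using assms(9) by (simp add: \<rho>_def)
  have nu: "norm u = pownorm (m - 1) \<mu>"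
    by (simp add: u_def norm_kron_vec norm_Lam assms(8) m_def)
  have ne: "u \<noteq> 0" "x \<noteq> 0"
    using nu pownorm_pos [of "m - 1" \<mu>] assms(8) by auto
  \<comment> \<open>Since \<open>norm v = 1\<close>, the residuals of \<open>L\<close> and
    \<open>P\<close> have the same norm.\<close>
  have Lu: "norm (meval L \<mu> *v u) = \<rho>"
    by (simp add: u_def right_ansatz_vector_mult_vec [OF assms(6)] norm_kron_vec assms(7) \<rho>_def)
  let ?R = "pownorm m \<mu> / (pownorm (m - 1) \<mu> * pownorm 1 \<mu>)"
  \<comment> \<open>The residual norm \<open>\<rho>\<close> and \<open>skew_factor M\<close> are
    positive and cancel in the quotient.\<close>
  have "structured_backward_error M 1 (skew_matpolys 1) \<mu> u L
      / structured_backward_error M m (skew_matpolys m) \<mu> x P = ?R"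
    using \<rho> skew_factor_pos [of M]
    unfolding skew_backward_error_formula [OF assms(4) ne(1)]
      skew_backward_error_formula [OF assms(1) [folded m_def] ne(2)]
    by (simp add: Lu nu assms(8) flip: \<rho>_def)
  \<comment> \<open>The unstructured errors do not depend on the kind of norm, so \<open>M'\<close>
    may differ from \<open>M\<close>.\<close>
  moreover have "backward_error M' 1 \<mu> u L / backward_error M' m \<mu> x P = ?R"
    using \<rho> by (simp add: backward_error_formula ne Lu nu assms(8) flip: \<rho>_def)
  ultimately show ?thesis
    using pownorm_ratio_bounds [OF m, of \<mu>]
    unfolding Let_def u_def [symmetric] m_def [symmetric] by simp
qed

end
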